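(* Let $a,b>0$ and let $E=\{(x,y)\in\mathbb{R}^2:\ \frac{x^2}{a^2}+\frac{y^2}{b^2}<1\}$ be the ellipse of semi-axes $a$ and $b$. Assume that there exists a function $u\in C^1(\overline{E})\cap C^2(E)$ such that $$-\Delta u=1\ \text{ in } E,\qquad u=0\ \text{ on } \partial E,$$ and such that, for some constant $c\in\mathbb{R}$, $$u_\nu=c\ \text{ on } \partial E.$$ Then $a=b$, that is, $E$ is a ball, and $u$ is radially symmetric.
   Context: $u_\nu$ denotes the derivative of $u$ in the direction of the exterior unit normal $\nu$ to $\partial E$. Radially symmetric means that $u(z)$ depends only on $|z|$, the distance of $z$ from the center (the origin) of $E$. *)

theory Defs
  imports "HOL-Analysis.Analysis"
begin

definition ellipse :: "real \<Rightarrow> real \<Rightarrow> (real \<times> real) set" where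
  "ellipse a b = {(x, y). x\<^sup>2 / a\<^sup>2 + y\<^sup>2 / b\<^sup>2 < 1}"

definition partial_deriv ::
  "'a::euclidean_space \<Rightarrow> ('a \<Rightarrow> real) \<Rightarrow> 'a \<Rightarrow> real" where
  "partial_deriv i u z = frechet_derivative u (at z) i"

definition laplacian :: "('a::euclidean_space \<Rightarrow> real) \<Rightarrow> 'a \<Rightarrow> real" where
  "laplacian u z = (\<Sum>i\<in>Basis. partial_deriv i (partial_deriv i u) z)"

text \<open>The next three notions are meant for an open set \<open>E\<close>. They depend only on the values
  of \<open>u\<close> on \<open>E\<close> (the first two) or on its closure (the third).\<close>

definition C1_on :: "'a::euclidean_space set \<Rightarrow> ('a \<Rightarrow> real) \<Rightarrow> bool" where
  "C1_on E u \<longleftrightarrow> (\<forall>z\<in>E. u differentiable (at z)) \<and>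
     (\<forall>i\<in>Basis. continuous_on E (partial_deriv i u))"

definition C2_on :: "'a::euclidean_space set \<Rightarrow> ('a \<Rightarrow> real) \<Rightarrow> bool" where
  "C2_on E u \<longleftrightarrow> C1_on E u \<and> (\<forall>i\<in>Basis. C1_on E (partial_deriv i u))"

text \<open>\<open>C\<^sup>1\<close> up to the boundary: \<open>u\<close> is continuous on the closure, and the first derivatives
  in the interior extend continuously to the closure.\<close>

definition C1_on_closure :: "'a::euclidean_space set \<Rightarrow> ('a \<Rightarrow> real) \<Rightarrow> bool" where
  "C1_on_closure E u \<longleftrightarrow> C1_on E u \<and> continuous_on (closure E) u \<and>
     (\<forall>i\<in>Basis. \<exists>g. continuous_on (closure E) g \<and> (\<forall>z\<in>E. g z = partial_deriv i u z))"

text \<open>Near the boundary point \<open>z\<close>, the set \<open>E\<close> is a strict sublevel set of a \<open>C\<^sup>1\<close> function \<open>\<rho>\<close>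
  with nonvanishing gradient \<open>G\<close> at \<open>z\<close>, and \<open>n\<close> is the normalised gradient.\<close>

definition is_exterior_unit_normal ::
  "'a::euclidean_space set \<Rightarrow> 'a \<Rightarrow> 'a \<Rightarrow> bool" where
  "is_exterior_unit_normal E z n \<longleftrightarrow>
     (\<exists>U \<rho> G. open U \<and> z \<in> U \<and> (\<forall>w\<in>U. GDERIV \<rho> w :> G w) \<and> continuous_on U G \<and>
        E \<inter> U = {w \<in> U. \<rho> w < 0} \<and> \<rho> z = 0 \<and> G z \<noteq> 0 \<and> n = G z /\<^sub>R norm (G z))"

lemma is_exterior_unit_normal_unique:
  fixes E :: "'a::euclidean_space set"
  assumes "is_exterior_unit_normal E z m" and "is_exterior_unit_normal E z n"
  shows "m = n"
proof (rule ccontr)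
  assume "m \<noteq> n"
  have ray: "eventually (\<lambda>t. (z + t *\<^sub>R v \<in> E) = (v \<bullet> k < 0)) (at_right 0)"
    if k: "is_exterior_unit_normal E z k" and v: "v \<bullet> k \<noteq> 0" for k v
  proof -
    obtain U \<rho> G where U: "open U" "z \<in> U" and G: "GDERIV \<rho> z :> G z"
      and E: "E \<inter> U = {w \<in> U. \<rho> w < 0}" and \<rho>: "\<rho> z = 0" and "G z \<noteq> 0"
      and keq: "k = G z /\<^sub>R norm (G z)"
      using k unfolding is_exterior_unit_normal_def by blast
    define h where "h = (\<lambda>t::real. \<rho> (z + t *\<^sub>R v))"
    have G': "(\<rho> has_derivative (\<lambda>h. h \<bullet> G z)) (at (z + 0 *\<^sub>R v))"
      using G by (simp add: gderiv_def inner_commute)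
    have "((\<lambda>t::real. z + t *\<^sub>R v) has_derivative (\<lambda>t. t *\<^sub>R v)) (at 0)"
      by (auto intro!: derivative_eq_intros)
    from has_derivative_compose[OF this G']
    have "(h has_derivative (\<lambda>t. (v \<bullet> G z) * t)) (at 0)"
      by (simp add: h_def mult.commute)
    then have D: "(h has_real_derivative v \<bullet> G z) (at 0)"
      by (simp add: has_field_derivative_def)
    have h0: "h 0 = 0" by (simp add: h_def \<rho>)
    have vk: "v \<bullet> G z = norm (G z) * (v \<bullet> k)"
      using \<open>G z \<noteq> 0\<close> by (simp add: keq)
    have "isCont (\<lambda>t::real. z + t *\<^sub>R v) 0" by simp
    then have "((\<lambda>t::real. z + t *\<^sub>R v) \<longlongrightarrow> z) (at_right 0)"
      by (auto simp: isCont_def intro: filterlim_at_within_not_equal tendsto_within_subset)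
    then have evU: "eventually (\<lambda>t. z + t *\<^sub>R v \<in> U) (at_right 0)"
      using U by (rule topological_tendstoD)
    have evh: "eventually (\<lambda>t. (h t < 0) = (v \<bullet> k < 0)) (at_right 0)"
    proof (cases "v \<bullet> k < 0")
      case True
      then have "v \<bullet> G z < 0" using vk \<open>G z \<noteq> 0\<close> by (simp add: mult_pos_neg)
      from DERIV_neg_dec_right[OF D this] show ?thesis
        using True h0 unfolding eventually_at_right_field by auto
    next
      case False
      then have "v \<bullet> G z > 0" using vk v \<open>G z \<noteq> 0\<close> by simp
      from DERIV_pos_inc_right[OF D this] obtain d where "d > 0" "\<forall>t>0. t < d \<longrightarrow> 0 < h t"
        using h0 by auto
      then show ?thesis
        using False unfolding eventually_at_right_field by (intro exI[of _ d]) auto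
    qed
    show ?thesis
      using evU evh by eventually_elim (use E in \<open>auto simp: h_def\<close>)
  qed
  have nrm: "norm m = 1" "norm n = 1"
    using assms unfolding is_exterior_unit_normal_def by auto
  define v where "v = n - m"
  have "v \<bullet> v > 0" using \<open>m \<noteq> n\<close> by (simp add: v_def)
  moreover have "m \<bullet> m = 1" "n \<bullet> n = 1" using nrm by (simp_all add: dot_square_norm)
  ultimately have "v \<bullet> m < 0" "v \<bullet> n > 0"
    by (simp_all add: v_def inner_diff_left inner_diff_right inner_commute)
  then have "eventually (\<lambda>t. z + t *\<^sub>R v \<in> E) (at_right (0::real))"
    and "eventually (\<lambda>t. z + t *\<^sub>R v \<notin> E) (at_right (0::real))"
    using ray[OF assms(1), of v] ray[OF assms(2), of v] by auto
  then have "eventually (\<lambda>t. False) (at_right (0::real))"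
    by eventually_elim simp
  then show False by simp
qed

definition exterior_unit_normal :: "'a::euclidean_space set \<Rightarrow> 'a \<Rightarrow> 'a" where
  "exterior_unit_normal E z = (THE n. is_exterior_unit_normal E z n)"

text \<open>The derivative of \<open>u\<close> at the boundary point \<open>z\<close> in the direction of the exterior normal \<open>\<nu>\<close>.
  It is one-sided, since \<open>u\<close> is only given on the closure of \<open>E\<close> and \<open>z + t \<nu>\<close> lies in \<open>E\<close>
  for small \<open>t < 0\<close>.\<close>

definition has_normal_derivative ::
  "('a::euclidean_space \<Rightarrow> real) \<Rightarrow> real \<Rightarrow> 'a set \<Rightarrow> 'a \<Rightarrow> bool" where
  "has_normal_derivative u c E z \<longleftrightarrow>
     ((\<lambda>t. u (z + t *\<^sub>R exterior_unit_normal E z)) has_real_derivative c) (at_left 0)"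

definition radially_symmetric_on ::
  "'a::real_normed_vector set \<Rightarrow> ('a \<Rightarrow> real) \<Rightarrow> bool" where
  "radially_symmetric_on S u \<longleftrightarrow> (\<exists>\<phi>. \<forall>z\<in>S. u z = \<phi> (norm z))"

end

theory Submission
  imports Defs
begin

text \<open>
  The Dirichlet problem alone already determines \<open>u\<close>: the quadratic
  \<open>k (1 - x\<^sup>2/a\<^sup>2 - y\<^sup>2/b\<^sup>2)\<close>, called \<open>bump a b k\<close> below, vanishes on the boundary of the
  ellipse and has the constant Laplacian \<open>- 2 k (1/a\<^sup>2 + 1/b\<^sup>2)\<close>, which is \<open>- 1\<close> for exactly one
  value \<open>K\<close> of \<open>k\<close>.

  That \<open>u\<close> equals \<open>bump a b K\<close> is a consequence of a strict comparison principle
  (\<open>strict_comparison\<close>): if \<open>u - q\<close> had an interior maximum, then the Laplacian of \<open>u\<close> could not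
  exceed that of \<open>q\<close> there. The family \<open>bump a b k\<close> supplies its own strict sub- and
  supersolutions: for \<open>k > K\<close> the Laplacian is below \<open>- 1\<close>, for \<open>k < K\<close> above it, and all members
  have the same boundary values. So \<open>bump a b k \<le> u \<le> bump a b k'\<close> for all \<open>k < K < k'\<close>, and
  \<open>k, k' \<rightarrow> K\<close> gives equality (\<open>torsion_function_ellipse\<close>).

  For this explicit function the normal derivative is \<open>- 2 K / a\<close> at the vertex \<open>(a, 0)\<close> and
  \<open>- 2 K / b\<close> at the vertex \<open>(0, b)\<close>. As both are equal to \<open>c\<close>, it follows that \<open>a = b\<close>, and then
  \<open>bump a a K\<close> is visibly radial.
\<close>

section \<open>A comparison principle for the Laplacian\<close>

text \<open>If \<open>D\<close> were positive, the derivative, which vanishes at the maximum, would be positive just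
  to the right of it, so \<open>g\<close> would increase there.\<close>

lemma second_derivative_nonpos_at_local_max:
  fixes g g' :: "real \<Rightarrow> real"
  assumes "d > 0" and max: "\<And>t. \<bar>t\<bar> < d \<Longrightarrow> g t \<le> g 0"
    and g': "\<And>t. \<bar>t\<bar> < d \<Longrightarrow> (g has_real_derivative g' t) (at t)"
    and D: "(g' has_real_derivative D) (at 0)"
  shows "D \<le> 0"
proof (rule ccontr)
  assume "\<not> D \<le> 0"
  then have "D > 0" by simp
  have "g' 0 = 0"
    using g'[of 0] \<open>d > 0\<close> max by (intro DERIV_local_max[of g _ 0 d]) auto
  with DERIV_pos_inc_right[OF D \<open>D > 0\<close>]
  obtain e where e: "e > 0" "\<And>t. 0 < t \<Longrightarrow> t < e \<Longrightarrow> g' t > 0" by auto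
  define s where "s = min d e / 2"
  have s: "0 < s" "s < d" "s < e" using \<open>d > 0\<close> \<open>e > 0\<close> by (auto simp: s_def min_def)
  obtain z where "0 < z" "z < s" "g s - g 0 = (s - 0) * g' z"
    using MVT2[of 0 s g g'] g' s by auto
  with e(2)[of z] s have "g s > g 0" by (smt (verit) mult_pos_pos)
  with max[of s] s show False by simp
qed

lemma has_real_derivative_along_line:
  assumes "u differentiable (at (z + t *\<^sub>R i))"
  shows "((\<lambda>t. u (z + t *\<^sub>R i)) has_real_derivative partial_deriv i u (z + t *\<^sub>R i)) (at t)"
proof -
  let ?F = "frechet_derivative u (at (z + t *\<^sub>R i))"
  have F: "(u has_derivative ?F) (at (z + t *\<^sub>R i))"
    using assms frechet_derivative_works by blast
  have "((\<lambda>t. z + t *\<^sub>R i) has_derivative (\<lambda>s. s *\<^sub>R i)) (at t)"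
    by (auto intro!: derivative_eq_intros)
  from has_derivative_compose[OF this F]
  have "((\<lambda>t. u (z + t *\<^sub>R i)) has_derivative (\<lambda>s. ?F (s *\<^sub>R i))) (at t)" .
  moreover have "?F (s *\<^sub>R i) = partial_deriv i u (z + t *\<^sub>R i) * s" for s
    using linear_cmul[OF has_derivative_linear[OF F]]
    by (simp add: partial_deriv_def mult.commute)
  ultimately show ?thesis
    by (simp add: has_field_derivative_def)
qed

text \<open>The second derivative test, applied along each coordinate line through \<open>z\<close>.\<close>

lemma laplacian_le_at_max_of_difference:
  fixes u q :: "'a::euclidean_space \<Rightarrow> real"
  assumes "open E" and u: "C2_on E u" and q: "C2_on E q" and "z \<in> E"
    and max: "\<And>w. w \<in> E \<Longrightarrow> u w - q w \<le> u z - q z"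
  shows "laplacian u z \<le> laplacian q z"
  unfolding laplacian_def
proof (rule sum_mono)
  fix i :: 'a assume i: "i \<in> Basis"
  obtain d where d: "d > 0" "ball z d \<subseteq> E"
    using \<open>open E\<close> \<open>z \<in> E\<close> open_contains_ball by blast
  have line: "z + t *\<^sub>R i \<in> E" if "\<bar>t\<bar> < d" for t
    using that d i by (auto simp: subset_iff dist_norm)
  have D: "f differentiable (at w)" "partial_deriv i f differentiable (at w)"
    if "f = u \<or> f = q" "w \<in> E" for f w
    using that u q i unfolding C2_on_def C1_on_def by auto
  let ?D = "\<lambda>f. partial_deriv i (partial_deriv i f) z"
  have "?D u - ?D q \<le> 0"
  proof (rule second_derivative_nonpos_at_local_max)
    show "d > 0" by fact
    show "u (z + t *\<^sub>R i) - q (z + t *\<^sub>R i) \<le> u (z + 0 *\<^sub>R i) - q (z + 0 *\<^sub>R i)"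
      if "\<bar>t\<bar> < d" for t using max[OF line[OF that]] by simp
    show "((\<lambda>t. u (z + t *\<^sub>R i) - q (z + t *\<^sub>R i)) has_real_derivative
        partial_deriv i u (z + t *\<^sub>R i) - partial_deriv i q (z + t *\<^sub>R i)) (at t)"
      if "\<bar>t\<bar> < d" for t
      using line[OF that] by (intro DERIV_diff has_real_derivative_along_line D) auto
    have "((\<lambda>t. partial_deriv i u (z + t *\<^sub>R i) - partial_deriv i q (z + t *\<^sub>R i))
        has_real_derivative partial_deriv i (partial_deriv i u) (z + 0 *\<^sub>R i)
          - partial_deriv i (partial_deriv i q) (z + 0 *\<^sub>R i)) (at 0)"
      using \<open>z \<in> E\<close> by (intro DERIV_diff has_real_derivative_along_line D) auto
    then show "((\<lambda>t. partial_deriv i u (z + t *\<^sub>R i) - partial_deriv i q (z + t *\<^sub>R i))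
        has_real_derivative ?D u - ?D q) (at 0)" by simp
  qed
  then show "?D u \<le> ?D q" by simp
qed

text \<open>A maximum point of \<open>u - q\<close> on the compact closure cannot lie in \<open>E\<close>, so it lies on the
  boundary.\<close>

lemma strict_comparison:
  fixes u q :: "'a::euclidean_space \<Rightarrow> real"
  assumes "open E" "bounded E"
    and "C2_on E u" "C2_on E q"
    and "continuous_on (closure E) u" "continuous_on (closure E) q"
    and lap: "\<And>z. z \<in> E \<Longrightarrow> laplacian q z < laplacian u z"
    and bdry: "\<And>z. z \<in> frontier E \<Longrightarrow> u z \<le> q z"
    and z: "z \<in> closure E"
  shows "u z \<le> q z"
proof -
  have "compact (closure E)" using \<open>bounded E\<close> by simp
  then obtain m where m: "m \<in> closure E"
      "\<And>w. w \<in> closure E \<Longrightarrow> u w - q w \<le> u m - q m"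
    using continuous_attains_sup[OF _ _ continuous_on_diff[OF assms(5,6)]] z
    by (metis empty_iff)
  have "m \<notin> E"
  proof
    assume "m \<in> E"
    have "laplacian u m \<le> laplacian q m"
      using assms(1,3,4) \<open>m \<in> E\<close>
      by (rule laplacian_le_at_max_of_difference) (use m(2) closure_subset in blast)
    with lap[OF \<open>m \<in> E\<close>] show False by simp
  qed
  then have "m \<in> frontier E"
    using m(1) \<open>open E\<close> by (simp add: frontier_def interior_open)
  with bdry[of m] m(2)[OF z] show ?thesis by force
qed

section \<open>Boundary and normal of the ellipse\<close>

lemma open_ellipse: "open (ellipse a b)"
  unfolding ellipse_def case_prod_unfold divide_inverse
  by (intro open_Collect_less continuous_intros)

lemma closure_ellipse_subset:
  "closure (ellipse a b) \<subseteq> {z. (fst z)\<^sup>2 / a\<^sup>2 + (snd z)\<^sup>2 / b\<^sup>2 \<le> 1}"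
proof (rule closure_minimal)
  show "closed {z::real \<times> real. (fst z)\<^sup>2 / a\<^sup>2 + (snd z)\<^sup>2 / b\<^sup>2 \<le> 1}"
    unfolding divide_inverse by (intro closed_Collect_le continuous_intros)
qed (auto simp: ellipse_def)

lemma bounded_ellipse:
  assumes "a > 0" "b > 0" shows "bounded (ellipse a b)"
proof (rule bounded_subset)
  show "bounded ({-a..a} \<times> {-b..b})" by (intro bounded_Times) auto
  show "ellipse a b \<subseteq> {-a..a} \<times> {-b..b}"
  proof clarify
    fix x y assume "(x, y) \<in> ellipse a b"
    then have "x\<^sup>2 / a\<^sup>2 + y\<^sup>2 / b\<^sup>2 < 1" by (simp add: ellipse_def)
    moreover have "x\<^sup>2 / a\<^sup>2 \<ge> 0" "y\<^sup>2 / b\<^sup>2 \<ge> 0" by auto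
    ultimately have "x\<^sup>2 / a\<^sup>2 \<le> 1" "y\<^sup>2 / b\<^sup>2 \<le> 1" by linarith+
    then have "x\<^sup>2 \<le> a\<^sup>2" "y\<^sup>2 \<le> b\<^sup>2" using assms by (auto simp: field_simps)
    then have "\<bar>x\<bar> \<le> a" "\<bar>y\<bar> \<le> b"
      using assms abs_le_square_iff[of x a] abs_le_square_iff[of y b] by auto
    then show "x \<in> {-a..a} \<and> y \<in> {-b..b}" by auto
  qed
qed

lemma ellipse_circle:
  assumes "a > 0" shows "ellipse a a = ball 0 a"
proof -
  have "x\<^sup>2 / a\<^sup>2 + y\<^sup>2 / a\<^sup>2 < 1 \<longleftrightarrow> sqrt (x\<^sup>2 + y\<^sup>2) < a" for x y
  proof -
    have "x\<^sup>2 / a\<^sup>2 + y\<^sup>2 / a\<^sup>2 < 1 \<longleftrightarrow> x\<^sup>2 + y\<^sup>2 < a\<^sup>2"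
      using assms by (simp add: add_divide_distrib[symmetric])
    also have "\<dots> \<longleftrightarrow> sqrt (x\<^sup>2 + y\<^sup>2) < sqrt (a\<^sup>2)" by (simp only: real_sqrt_less_iff)
    finally show ?thesis using assms by simp
  qed
  then show ?thesis by (auto simp: ellipse_def dist_norm norm_Pair)
qed

text \<open>A point \<open>z\<close> of the level set \<open>1\<close> is a limit of the interior points \<open>t z\<close> with
  \<open>0 < t < 1\<close>.\<close>

lemma frontier_ellipse:
  "frontier (ellipse a b) = {z. (fst z)\<^sup>2 / a\<^sup>2 + (snd z)\<^sup>2 / b\<^sup>2 = 1}"
proof
  show "{z. (fst z)\<^sup>2 / a\<^sup>2 + (snd z)\<^sup>2 / b\<^sup>2 = 1} \<subseteq> frontier (ellipse a b)"
  proof clarify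
    fix x y assume xy: "(fst (x, y))\<^sup>2 / a\<^sup>2 + (snd (x, y))\<^sup>2 / b\<^sup>2 = 1"
    let ?f = "\<lambda>t::real. t *\<^sub>R (x, y)"
    have "?f t \<in> ellipse a b" if "t \<in> {0<..<1}" for t
    proof -
      have "(t * x)\<^sup>2 / a\<^sup>2 + (t * y)\<^sup>2 / b\<^sup>2 = t\<^sup>2 * (x\<^sup>2 / a\<^sup>2 + y\<^sup>2 / b\<^sup>2)"
        by (simp add: power_mult_distrib distrib_left)
      also have "\<dots> < 1" using xy that by (simp add: power_less_one_iff)
      finally show ?thesis by (simp add: ellipse_def)
    qed
    then have "?f ` closure {0<..<1} \<subseteq> closure (ellipse a b)"
      by (intro image_closure_subset continuous_intros) (use closure_subset in blast)+
    moreover have "(1::real) \<in> closure {0<..<1}" by simp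
    ultimately have "?f 1 \<in> closure (ellipse a b)" by blast
    moreover have "(x, y) \<notin> ellipse a b" using xy by (simp add: ellipse_def)
    ultimately show "(x, y) \<in> frontier (ellipse a b)"
      by (simp add: frontier_def interior_open[OF open_ellipse])
  qed
next
  show "frontier (ellipse a b) \<subseteq> {z. (fst z)\<^sup>2 / a\<^sup>2 + (snd z)\<^sup>2 / b\<^sup>2 = 1}"
  proof clarify
    fix x y assume "(x, y) \<in> frontier (ellipse a b)"
    then have "(x, y) \<in> closure (ellipse a b)" "(x, y) \<notin> ellipse a b"
      by (simp_all add: frontier_def interior_open[OF open_ellipse])
    with closure_ellipse_subset[of a b]
    show "(fst (x, y))\<^sup>2 / a\<^sup>2 + (snd (x, y))\<^sup>2 / b\<^sup>2 = 1"
      by (force simp: ellipse_def)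
  qed
qed

text \<open>The function \<open>\<rho>(x, y) = x\<^sup>2/a\<^sup>2 + y\<^sup>2/b\<^sup>2 - 1\<close> defines the whole ellipse, and its gradient is
  \<open>2 g\<close>.\<close>

lemma exterior_unit_normal_ellipse:
  fixes x y a b :: real
  assumes "x\<^sup>2 / a\<^sup>2 + y\<^sup>2 / b\<^sup>2 = 1"
  defines "g \<equiv> (x / a\<^sup>2, y / b\<^sup>2)"
  shows "exterior_unit_normal (ellipse a b) (x, y) = g /\<^sub>R norm g"
proof -
  define \<rho> :: "real \<times> real \<Rightarrow> real" where "\<rho> = (\<lambda>z. (fst z)\<^sup>2 / a\<^sup>2 + (snd z)\<^sup>2 / b\<^sup>2 - 1)"
  define G :: "real \<times> real \<Rightarrow> real \<times> real" where
    "G = (\<lambda>z. (2 * fst z / a\<^sup>2, 2 * snd z / b\<^sup>2))"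
  have G2: "G (x, y) = 2 *\<^sub>R g" by (simp add: G_def g_def)
  have "g \<noteq> 0" using assms by (auto simp: zero_prod_def)
  have "GDERIV \<rho> w :> G w" for w
  proof -
    have "\<rho> = (\<lambda>z. (fst z)\<^sup>2 * inverse (a\<^sup>2) + (snd z)\<^sup>2 * inverse (b\<^sup>2) - 1)"
      by (simp add: \<rho>_def divide_inverse)
    then show ?thesis unfolding gderiv_def
      by (auto simp: G_def inner_prod_def divide_inverse algebra_simps intro!: derivative_eq_intros ext)
  qed
  moreover have "continuous_on UNIV G"
    unfolding G_def divide_inverse by (intro continuous_intros)
  moreover have "ellipse a b = {w. \<rho> w < 0}" by (auto simp: ellipse_def \<rho>_def)
  moreover have "\<rho> (x, y) = 0" using assms by (simp add: \<rho>_def)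
  moreover have "g /\<^sub>R norm g = G (x, y) /\<^sub>R norm (G (x, y))" by (simp add: G2)
  ultimately have "is_exterior_unit_normal (ellipse a b) (x, y) (g /\<^sub>R norm g)"
    unfolding is_exterior_unit_normal_def
    using \<open>g \<noteq> 0\<close> G2 by (intro exI[of _ UNIV] exI[of _ \<rho>] exI[of _ G]) auto
  then show ?thesis
    unfolding exterior_unit_normal_def
    using is_exterior_unit_normal_unique by (blast intro: the_equality)
qed

text \<open>Along the normal line \<open>\<rho>\<close> is the quadratic \<open>t (2 \<bar>g\<bar> + t Q)\<close>, whose sign for small
  \<open>t\<close> is that of \<open>t\<close>.\<close>

lemma eventually_inward_normal_in_ellipse:
  fixes x y a b :: real
  assumes xy: "x\<^sup>2 / a\<^sup>2 + y\<^sup>2 / b\<^sup>2 = 1"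
  shows "\<forall>\<^sub>F t in at_left 0.
    (x, y) + t *\<^sub>R exterior_unit_normal (ellipse a b) (x, y) \<in> ellipse a b"
proof -
  define g where "g = (x / a\<^sup>2, y / b\<^sup>2)"
  define n where "n = g /\<^sub>R norm g"
  define Q where "Q = (fst n)\<^sup>2 / a\<^sup>2 + (snd n)\<^sup>2 / b\<^sup>2"
  have n: "exterior_unit_normal (ellipse a b) (x, y) = n"
    using exterior_unit_normal_ellipse[OF xy] by (simp add: n_def g_def)
  have "g \<noteq> 0" using xy by (auto simp: g_def zero_prod_def)
  have gn: "x * fst n / a\<^sup>2 + y * snd n / b\<^sup>2 = norm g"
  proof -
    have "x * fst n / a\<^sup>2 + y * snd n / b\<^sup>2 = g \<bullet> n" by (simp add: g_def inner_prod_def)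
    also have "\<dots> = norm g"
      using \<open>g \<noteq> 0\<close> by (simp add: n_def dot_square_norm power2_eq_square)
    finally show ?thesis .
  qed
  have expand:
    "(x + t * fst n)\<^sup>2 / a\<^sup>2 + (y + t * snd n)\<^sup>2 / b\<^sup>2
      = 1 + t * (2 * norm g + t * Q)" for t
    unfolding gn[symmetric] xy[symmetric] Q_def
    by (simp add: power2_eq_square algebra_simps add_divide_distrib)
  have "((\<lambda>t. 2 * norm g + t * Q) \<longlongrightarrow> 2 * norm g + 0 * Q) (at_left 0)"
    by (intro tendsto_intros)
  then have "\<forall>\<^sub>F t in at_left 0. 2 * norm g + t * Q > 0"
    by (rule order_tendstoD) (use \<open>g \<noteq> 0\<close> in simp)
  moreover have "\<forall>\<^sub>F t in at_left (0::real). t < 0"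
    by (simp add: eventually_at_filter)
  ultimately show ?thesis
  proof eventually_elim
    case (elim t)
    then have "1 + t * (2 * norm g + t * Q) < 1" by (simp add: mult_neg_pos)
    with expand[of t] show ?case
      unfolding n by (cases n) (simp add: ellipse_def)
  qed
qed

section \<open>The torsion function of the ellipse\<close>

definition bump :: "real \<Rightarrow> real \<Rightarrow> real \<Rightarrow> real \<times> real \<Rightarrow> real" where
  "bump a b k z = k * (1 - (fst z)\<^sup>2 / a\<^sup>2 - (snd z)\<^sup>2 / b\<^sup>2)"

lemma partial_deriv_eqI:
  "(u has_derivative F) (at z) \<Longrightarrow> partial_deriv i u z = F i"
  by (simp add: partial_deriv_def frechet_derivative_at[symmetric])

lemma Basis_real_prod: "Basis = {(1, 0), (0, 1) :: real \<times> real}"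
  by (auto simp: Basis_prod_def)

lemma bump_has_derivative:
  "(bump a b k has_derivative
     (\<lambda>h. - 2 * k * (fst z * fst h / a\<^sup>2 + snd z * snd h / b\<^sup>2))) (at z)"
proof -
  have "bump a b k = (\<lambda>z. k * (1 - (fst z)\<^sup>2 * inverse (a\<^sup>2) - (snd z)\<^sup>2 * inverse (b\<^sup>2)))"
    by (simp add: bump_def divide_inverse fun_eq_iff)
  then show ?thesis
    by (auto simp: divide_inverse algebra_simps intro!: derivative_eq_intros ext)
qed

lemma partial_deriv_bump:
  "partial_deriv i (bump a b k) = (\<lambda>z. - 2 * k * (fst z * fst i / a\<^sup>2 + snd z * snd i / b\<^sup>2))"
  using partial_deriv_eqI[OF bump_has_derivative] by blast

lemma partial_deriv_bump_has_derivative: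
  "(partial_deriv i (bump a b k) has_derivative
     (\<lambda>h. - 2 * k * (fst h * fst i / a\<^sup>2 + snd h * snd i / b\<^sup>2))) (at z)"
  unfolding partial_deriv_bump divide_inverse
  by (auto simp: algebra_simps intro!: derivative_eq_intros ext)

lemma partial_deriv2_bump:
  "partial_deriv j (partial_deriv i (bump a b k)) =
     (\<lambda>z. - 2 * k * (fst j * fst i / a\<^sup>2 + snd j * snd i / b\<^sup>2))"
  using partial_deriv_eqI[OF partial_deriv_bump_has_derivative] by blast

lemma C2_on_bump: "C2_on E (bump a b k)"
proof -
  have "continuous_on E (partial_deriv i (bump a b k))" for i
    unfolding partial_deriv_bump divide_inverse by (intro continuous_intros)
  moreover have "continuous_on E (partial_deriv j (partial_deriv i (bump a b k)))" for i j
    unfolding partial_deriv2_bump by (rule continuous_on_const)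
  ultimately show ?thesis
    unfolding C2_on_def C1_on_def differentiable_def
    using bump_has_derivative partial_deriv_bump_has_derivative by blast
qed

lemma laplacian_bump: "laplacian (bump a b k) z = - 2 * k * (1 / a\<^sup>2 + 1 / b\<^sup>2)"
  unfolding laplacian_def partial_deriv2_bump Basis_real_prod
  by (simp add: algebra_simps)

text \<open>Strict comparison with \<open>bump a b k\<close> for \<open>k\<close> above and below the value
  that gives the right Laplacian; a limit in \<open>k\<close> replaces the usual perturbation by a small
  multiple of \<open>\<bar>z\<bar>\<^sup>2\<close>.\<close>

lemma torsion_function_ellipse:
  assumes "a > 0" "b > 0"
    and cont: "continuous_on (closure (ellipse a b)) u" and C2: "C2_on (ellipse a b) u"
    and lap: "\<And>z. z \<in> ellipse a b \<Longrightarrow> - laplacian u z = 1"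
    and bdry: "\<And>z. z \<in> frontier (ellipse a b) \<Longrightarrow> u z = 0"
    and z: "z \<in> closure (ellipse a b)"
  defines "K \<equiv> 1 / (2 * (1 / a\<^sup>2 + 1 / b\<^sup>2))"
  shows "u z = bump a b K z"
proof -
  define s where "s = 1 / a\<^sup>2 + 1 / b\<^sup>2"
  have "s > 0" using assms(1,2) by (simp add: s_def add_pos_pos)
  have K: "K = 1 / (2 * s)" by (simp add: K_def s_def)
  have bump_cont: "continuous_on S (bump a b k)" for S k
    using has_derivative_continuous[OF bump_has_derivative]
    by (intro continuous_at_imp_continuous_on) blast
  have bump_bdry: "bump a b k w = 0" if "w \<in> frontier (ellipse a b)" for k w
    using that by (auto simp: frontier_ellipse bump_def algebra_simps)
  have upper: "u z \<le> bump a b k z" if "k > K" for k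
  proof (rule strict_comparison[of "ellipse a b"])
    fix w assume w: "w \<in> ellipse a b"
    have "2 * k * s > 1" using that \<open>s > 0\<close> by (simp add: K field_simps)
    with lap[OF w] show "laplacian (bump a b k) w < laplacian u w"
      unfolding laplacian_bump s_def[symmetric] by linarith
  qed (simp_all add: open_ellipse bounded_ellipse assms(1,2) C2 C2_on_bump cont bump_cont
      z bdry bump_bdry)
  have lower: "bump a b k z \<le> u z" if "k < K" for k
  proof (rule strict_comparison[of "ellipse a b"])
    fix w assume w: "w \<in> ellipse a b"
    have "2 * k * s < 1" using that \<open>s > 0\<close> by (simp add: K field_simps)
    with lap[OF w] show "laplacian u w < laplacian (bump a b k) w"
      unfolding laplacian_bump s_def[symmetric] by linarith
  qed (simp_all add: open_ellipse bounded_ellipse assms(1,2) C2 C2_on_bump cont bump_cont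
      z bdry bump_bdry)
  have lim: "((\<lambda>k. bump a b k z) \<longlongrightarrow> bump a b K z) (at K within S)" for S
    unfolding bump_def by (intro tendsto_intros)
  show ?thesis
  proof (rule antisym)
    show "u z \<le> bump a b K z"
      by (rule tendsto_lowerbound[OF lim[of "{K<..}"]])
         (use upper in \<open>auto simp: eventually_at_filter\<close>)
    show "bump a b K z \<le> u z"
      by (rule tendsto_upperbound[OF lim[of "{..<K}"]])
         (use lower in \<open>auto simp: eventually_at_filter\<close>)
  qed
qed

section \<open>Overdetermination at the boundary\<close>

text \<open>The normal derivative is one-sided, so it only sees the values on the closure, provided
  that the inward normal ray starts inside \<open>E\<close>.\<close>

lemma has_normal_derivative_cong:
  assumes "\<And>w. w \<in> closure E \<Longrightarrow> u w = v w" and "z \<in> closure E"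
    and "\<forall>\<^sub>F t in at_left 0. z + t *\<^sub>R exterior_unit_normal E z \<in> E"
  shows "has_normal_derivative u c E z \<longleftrightarrow> has_normal_derivative v c E z"
  unfolding has_normal_derivative_def
proof (rule has_field_derivative_cong_eventually)
  let ?l = "\<lambda>t. z + t *\<^sub>R exterior_unit_normal E z"
  show "\<forall>\<^sub>F t in at_left 0. u (?l t) = v (?l t)"
    using assms(3) by eventually_elim (use assms(1) closure_subset in blast)
  show "u (?l 0) = v (?l 0)" using assms(1,2) by simp
qed

text \<open>On the boundary the gradient of \<open>bump a b k\<close> is \<open>- 2 k g\<close>, where \<open>g = (x/a\<^sup>2, y/b\<^sup>2)\<close> has
  the direction of the exterior normal.\<close>

lemma normal_derivative_bump:
  fixes x y a b k c :: real
  assumes xy: "x\<^sup>2 / a\<^sup>2 + y\<^sup>2 / b\<^sup>2 = 1"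
    and c: "has_normal_derivative (bump a b k) c (ellipse a b) (x, y)"
  shows "c = - 2 * k * norm (x / a\<^sup>2, y / b\<^sup>2)"
proof -
  define g where "g = (x / a\<^sup>2, y / b\<^sup>2)"
  define n where "n = g /\<^sub>R norm g"
  have "g \<noteq> 0"
  proof
    assume "g = 0"
    then have "x / a\<^sup>2 = 0" "y / b\<^sup>2 = 0" by (simp_all only: g_def zero_prod_def prod.inject)
    with xy show False by (auto simp: divide_simps split: if_splits)
  qed
  have "bump a b k differentiable (at ((x, y) + 0 *\<^sub>R n))"
    by (rule differentiableI, rule bump_has_derivative)
  from has_real_derivative_along_line[OF this]
  have "((\<lambda>t. bump a b k ((x, y) + t *\<^sub>R n)) has_real_derivative
      partial_deriv n (bump a b k) (x, y)) (at_left 0)"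
    by (simp only: scaleR_zero_left add_0_right has_field_derivative_at_within)
  moreover have "((\<lambda>t. bump a b k ((x, y) + t *\<^sub>R n)) has_real_derivative c) (at_left 0)"
    using c by (simp only: has_normal_derivative_def exterior_unit_normal_ellipse[OF xy] n_def g_def)
  ultimately have "c = partial_deriv n (bump a b k) (x, y)"
    unfolding has_field_derivative_iff
    by (intro tendsto_unique[OF trivial_limit_at_left_real])
  also have "\<dots> = - 2 * k * (g \<bullet> n)"
    by (simp add: partial_deriv_bump g_def inner_prod_def)
  also have "g \<bullet> n = norm g"
    using \<open>g \<noteq> 0\<close> by (simp add: n_def dot_square_norm power2_eq_square)
  finally show ?thesis by (simp add: g_def)
qed

theorem theorem2p4:
  fixes a b c :: real and u :: "real \<times> real \<Rightarrow> real"
  assumes "a > 0" and "b > 0"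
    and "C1_on_closure (ellipse a b) u" and "C2_on (ellipse a b) u"
    and "\<forall>z\<in>ellipse a b. - laplacian u z = 1"
    and "\<forall>z\<in>frontier (ellipse a b). u z = 0"
    and "\<forall>z\<in>frontier (ellipse a b). has_normal_derivative u c (ellipse a b) z"
  shows "a = b \<and> (\<exists>r>0. ellipse a b = ball 0 r) \<and>
    radially_symmetric_on (closure (ellipse a b)) u"
proof -
  let ?E = "ellipse a b"
  define K where "K = 1 / (2 * (1 / a\<^sup>2 + 1 / b\<^sup>2))"
  have u: "u z = bump a b K z" if "z \<in> closure ?E" for z
    unfolding K_def using assms that
    by (intro torsion_function_ellipse) (auto simp: C1_on_closure_def)
  have c: "c = - 2 * K * norm (x / a\<^sup>2, y / b\<^sup>2)"
    if xy: "x\<^sup>2 / a\<^sup>2 + y\<^sup>2 / b\<^sup>2 = 1" for x y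
  proof -
    have fr: "(x, y) \<in> frontier ?E" using xy by (simp add: frontier_ellipse)
    then have "has_normal_derivative (bump a b K) c ?E (x, y)"
      using has_normal_derivative_cong[where u = u and v = "bump a b K",
          OF u _ eventually_inward_normal_in_ellipse[OF xy]] assms(7)
      by (auto simp: frontier_def)
    then show ?thesis by (rule normal_derivative_bump[OF xy])
  qed
  have "c = - 2 * K / a"
    using c[of a 0] assms(1) by (simp add: norm_Pair power2_eq_square real_sqrt_divide)
  moreover have "c = - 2 * K / b"
    using c[of 0 b] assms(2) by (simp add: norm_Pair power2_eq_square real_sqrt_divide)
  moreover have "K > 0" using assms(1,2) by (simp add: K_def add_pos_pos)
  ultimately have "a = b" using assms(1,2) by (simp add: field_simps)
  moreover have "\<exists>r>0. ?E = ball 0 r" using ellipse_circle assms(1) \<open>a = b\<close> by blast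
  moreover have "radially_symmetric_on (closure ?E) u"
    unfolding radially_symmetric_on_def
  proof (intro exI ballI)
    fix z assume "z \<in> closure ?E"
    then show "u z = K * (1 - (norm z)\<^sup>2 / a\<^sup>2)"
      using u \<open>a = b\<close> by (cases z) (simp add: bump_def norm_Pair add_divide_distrib)
  qed
  ultimately show ?thesis by blast
qed

end
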